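(* Let $p,g_1,\ldots,g_m$ be real polynomials in $n$ variables, $S=\{x\in\mathbb{R}^n: g_i(x)\ge0,\ i=1,\ldots,m\}$, $p^*=\inf_{x\in S}p(x)$, and let $d,R,\eta_i,\beta$ and the form $f_\gamma$ be as in the context; put $N=n+m+3$ and $D=2d$, so that $f_\gamma\in H_{N,2D}$. Let $K^r_{N,2D}$ ($r=0,1,2,\ldots$) be a sequence of sets of forms in $N$ variables and of degree $2D$ such that: (a) $K^r_{N,2D}\subseteq P_{N,2D}$ for all $r$, and there exists a positive definite form $s_{N,2D}\in K^0_{N,2D}$; (b) if a form $q\in H_{N,2D}$ is positive definite, then there exists $r\in\mathbb{N}$ such that $q\in K^r_{N,2D}$; (c) $K^r_{N,2D}\subseteq K^{r+1}_{N,2D}$ for all $r$; (d) if $q\in K^r_{N,2D}$, then $q+\epsilon s_{N,2D}\in K^r_{N,2D}$ for all $\epsilon\in[0,1]$. For $r\ge1$ define $$l_r:=\sup\Big\{\gamma\in\mathbb{R}: f_\gamma(z)-\tfrac1r s_{N,2D}(z)\in K^r_{N,2D}\Big\}.$$ Then $l_r\le p^*$ for all $r$, the sequence $\{l_r\}$ is nondecreasing, and $\lim_{r\to\infty}l_r=p^*$.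
   Context: $H_{N,2D}$ is the set of forms (homogeneous polynomials) in $N$ variables of degree $2D$ and $P_{N,2D}$ its subset of nonnegative forms; a form is positive definite if it is positive at all nonzero points. Data of the polynomial optimization problem $\inf_{x\in S}p(x)$: $d\ge1$ is such that $2d$ is the smallest positive even integer larger than or equal to the maximum degree of $p,g_1,\ldots,g_m$; $R>0$ satisfies $\sum_i x_i^2\le R$ for all $x\in S$; $\eta_i,\beta\in\mathbb{R}$ satisfy $g_i(x)\le\eta_i$ and $-p(x)\le\beta$ for all $x\in S$. With $z=(x_1,\ldots,x_n,s_0,\ldots,s_{m+1},y)$, $$f_\gamma(z):=\left(\gamma y^{2d}-y^{2d}p(x/y)-s_0^2y^{2d-2}\right)^2+\sum_{i=1}^m\left(y^{2d}g_i(x/y)-s_i^2y^{2d-2}\right)^2+\left(\Big(R+\sum_{i=1}^m\eta_i+\beta+\gamma\Big)^dy^{2d}-\Big(\sum_{i=1}^n x_i^2+\sum_{i=0}^m s_i^2\Big)^d-s_{m+1}^{2d}\right)^2 ,$$ a form of degree $4d=2D$ in $N=n+m+3$ variables, where $y^{2d}q(x/y)$ is the degree-$2d$ homogenization of $q$. Convention: $\sup\emptyset=-\infty$. *)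

theory Defs
  imports
    "HOL-Analysis.Analysis"
    "HOL-Library.Poly_Mapping"
begin

text \<open>Real polynomials in the variables \<open>X\<^sub>0, X\<^sub>1, \<dots>\<close>: finitely supported maps from
  monomials to coefficients, where a monomial maps each variable to its exponent. The ring
  operations are those of the Poly_Mapping theory. A point of \<open>\<real>\<^sup>k\<close> is an extensional
  function on \<open>{..<k}\<close>.\<close>

type_synonym rpoly = "(nat \<Rightarrow>\<^sub>0 nat) \<Rightarrow>\<^sub>0 real"

abbreviation points :: "nat \<Rightarrow> (nat \<Rightarrow> real) set" where
  "points k \<equiv> {..<k} \<rightarrow>\<^sub>E UNIV"

definition Var :: "nat \<Rightarrow> rpoly" where
  "Var i = Poly_Mapping.single (Poly_Mapping.single i 1) 1"

definition Const :: "real \<Rightarrow> rpoly" where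
  "Const c = Poly_Mapping.single 0 c"

definition mdeg :: "(nat \<Rightarrow>\<^sub>0 nat) \<Rightarrow> nat" where
  "mdeg t = (\<Sum>i\<in>Poly_Mapping.keys t. Poly_Mapping.lookup t i)"

text \<open>The zero polynomial gets degree \<open>0\<close>.\<close>

definition total_degree :: "rpoly \<Rightarrow> nat" where
  "total_degree q = Max (insert 0 (mdeg ` Poly_Mapping.keys q))"

definition polys :: "nat \<Rightarrow> rpoly set" where
  "polys k = {q. \<forall>t\<in>Poly_Mapping.keys q. Poly_Mapping.keys t \<subseteq> {..<k}}"

definition peval :: "rpoly \<Rightarrow> (nat \<Rightarrow> real) \<Rightarrow> real" where
  "peval q x = (\<Sum>t\<in>Poly_Mapping.keys q. Poly_Mapping.lookup q t *
     (\<Prod>i\<in>Poly_Mapping.keys t. x i ^ Poly_Mapping.lookup t i))"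

text \<open>As usual, the zero polynomial counts as a form of every degree.\<close>

definition forms :: "nat \<Rightarrow> nat \<Rightarrow> rpoly set" where
  "forms N k = {q \<in> polys N. \<forall>t\<in>Poly_Mapping.keys q. mdeg t = k}"

definition nonneg_forms :: "nat \<Rightarrow> nat \<Rightarrow> rpoly set" where
  "nonneg_forms N k = {q \<in> forms N k. \<forall>z\<in>points N. 0 \<le> peval q z}"

definition pos_def_forms :: "nat \<Rightarrow> nat \<Rightarrow> rpoly set" where
  "pos_def_forms N k =
     {q \<in> forms N k. \<forall>z\<in>points N. (\<exists>i<N. z i \<noteq> 0) \<longrightarrow> 0 < peval q z}"

text \<open>\<open>homog v k q\<close> is \<open>y\<^sup>k q(x/y)\<close> with \<open>y = X\<^sub>v\<close>; it is meant for
  \<open>k \<ge> total_degree q\<close>, so that the subtraction below does not truncate.\<close>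

definition homog :: "nat \<Rightarrow> nat \<Rightarrow> rpoly \<Rightarrow> rpoly" where
  "homog v k q = (\<Sum>t\<in>Poly_Mapping.keys q.
     Poly_Mapping.single (t + Poly_Mapping.single v (k - mdeg t)) (Poly_Mapping.lookup q t))"

definition feasible :: "nat \<Rightarrow> nat \<Rightarrow> (nat \<Rightarrow> rpoly) \<Rightarrow> (nat \<Rightarrow> real) set" where
  "feasible n m g = {x \<in> points n. \<forall>i\<in>{1..m}. 0 \<le> peval (g i) x}"

text \<open>Extended-real valued: the infimum over an empty feasible set is \<open>\<infinity>\<close>.\<close>

definition opt_value :: "nat \<Rightarrow> nat \<Rightarrow> rpoly \<Rightarrow> (nat \<Rightarrow> rpoly) \<Rightarrow> ereal" where
  "opt_value n m p g = (INF x\<in>feasible n m g. ereal (peval p x))"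

text \<open>The \<open>n + m + 3\<close> variables \<open>(x\<^sub>1, \<dots>, x\<^sub>n, s\<^sub>0, \<dots>, s\<^bsub>m+1\<^esub>, y)\<close> are numbered from
  \<open>0\<close> in this order.\<close>

definition f_form :: "nat \<Rightarrow> nat \<Rightarrow> nat \<Rightarrow> real \<Rightarrow> (nat \<Rightarrow> real) \<Rightarrow> real \<Rightarrow>
    rpoly \<Rightarrow> (nat \<Rightarrow> rpoly) \<Rightarrow> real \<Rightarrow> rpoly" where
  "f_form n m d R \<eta> \<beta> p g \<gamma> =
     (let v = n + m + 2; y = Var v; s = (\<lambda>i. Var (n + i)) in
        (Const \<gamma> * y ^ (2 * d) - homog v (2 * d) p - s 0 ^ 2 * y ^ (2 * d - 2)) ^ 2
      + (\<Sum>i=1..m. (homog v (2 * d) (g i) - s i ^ 2 * y ^ (2 * d - 2)) ^ 2)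
      + (Const ((R + (\<Sum>i=1..m. \<eta> i) + \<beta> + \<gamma>) ^ d) * y ^ (2 * d)
          - ((\<Sum>j<n. Var j ^ 2) + (\<Sum>i=0..m. s i ^ 2)) ^ d
          - s (m + 1) ^ (2 * d)) ^ 2)"

definition lower_bound :: "(nat \<Rightarrow> rpoly set) \<Rightarrow> (real \<Rightarrow> rpoly) \<Rightarrow> rpoly \<Rightarrow> nat \<Rightarrow> ereal" where
  "lower_bound K f s r = (SUP \<gamma>\<in>{\<gamma>. f \<gamma> - Const (1 / real r) * s \<in> K r}. ereal \<gamma>)"

end

theory Submission
  imports Defs
begin

text \<open>
  The form \<open>f\<^sub>\<gamma>\<close> is a sum of squares whose simultaneous vanishing encodes a feasible point of
  value at most \<open>\<gamma>\<close>. At \<open>y = 0\<close> the last square reduces to the square of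
  \<open>- (\<Sum>x\<^sub>i\<^sup>2 + \<Sum>s\<^sub>i\<^sup>2)\<^sup>d - s\<^bsub>m+1\<^esub>\<^bsup>2d\<^esup>\<close> and forces \<open>z = 0\<close>; at \<open>y \<noteq> 0\<close>, division by \<open>y\<^bsup>2d\<^esup>\<close> turns the
  first squares into \<open>\<gamma> - p(x/y) = (s\<^sub>0/y)\<^sup>2\<close> and \<open>g\<^sub>i(x/y) = (s\<^sub>i/y)\<^sup>2\<close>. So \<open>f\<^sub>\<gamma>\<close> is positive
  definite as soon as \<open>\<gamma> < p\<^sup>*\<close> (\<open>f_form_pos_def\<close>). Conversely, a feasible \<open>x\<close> with
  \<open>p(x) \<le> \<gamma>\<close> yields a zero of \<open>f\<^sub>\<gamma>\<close> with \<open>y = 1\<close>: the slacks \<open>s\<^sub>0, \<dots>, s\<^sub>m\<close> are square roots, and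
  the bounds \<open>R, \<eta>\<^sub>i, \<beta>\<close> are what makes the last slack \<open>s\<^bsub>m+1\<^esub>\<close> real (\<open>f_form_zero\<close>).

  Upper bound: if \<open>f\<^sub>\<gamma> - s/r\<close> lies in \<open>K\<^sup>r\<close>, it is nonnegative, so \<open>f\<^sub>\<gamma>\<close> has no nonzero zero,
  hence no feasible point has value at most \<open>\<gamma>\<close>.

  Monotonicity: \<open>f\<^sub>\<gamma> - s/r' = (f\<^sub>\<gamma> - s/r) + (1/r - 1/r') s\<close>, and the sets \<open>K\<^sup>r\<close> absorb the
  added multiple of \<open>s\<close> (\<open>certificate_mono\<close>).

  Convergence: let \<open>\<gamma> < p\<^sup>*\<close>. Compactness of the unit sphere gives \<open>k\<close> such that \<open>f\<^sub>\<gamma> - s/k\<close>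
  is still positive definite (\<open>pos_def_minus_small_multiple\<close>), so it lies in some \<open>K\<^sup>r\<close>, and by
  monotonicity \<open>\<gamma>\<close> is admissible at all later levels. Hence \<open>l\<^sub>r \<ge> \<gamma>\<close> eventually.
\<close>

section \<open>Evaluation is a ring homomorphism\<close>

definition monom_eval :: "(nat \<Rightarrow>\<^sub>0 nat) \<Rightarrow> (nat \<Rightarrow> real) \<Rightarrow> real" where
  "monom_eval t x = (\<Prod>i\<in>Poly_Mapping.keys t. x i ^ Poly_Mapping.lookup t i)"

lemma monom_eval_superset:
  assumes "finite A" "Poly_Mapping.keys t \<subseteq> A"
  shows "monom_eval t x = (\<Prod>i\<in>A. x i ^ Poly_Mapping.lookup t i)"
  unfolding monom_eval_def
  by (rule prod.mono_neutral_left) (use assms in \<open>auto simp: in_keys_iff\<close>)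

lemma mdeg_superset:
  assumes "finite A" "Poly_Mapping.keys t \<subseteq> A"
  shows "mdeg t = (\<Sum>i\<in>A. Poly_Mapping.lookup t i)"
  unfolding mdeg_def
  by (rule sum.mono_neutral_left) (use assms in \<open>auto simp: in_keys_iff\<close>)

lemma monom_eval_add: "monom_eval (t + u) x = monom_eval t x * monom_eval u x"
proof -
  let ?A = "Poly_Mapping.keys t \<union> Poly_Mapping.keys u"
  have "Poly_Mapping.keys (t + u) \<subseteq> ?A" by (rule Poly_Mapping.keys_add)
  then show ?thesis
    by (simp add: monom_eval_superset[of ?A] lookup_add power_add prod.distrib)
qed

lemma mdeg_add: "mdeg (t + u) = mdeg t + mdeg u"
proof -
  let ?A = "Poly_Mapping.keys t \<union> Poly_Mapping.keys u"
  have "Poly_Mapping.keys (t + u) \<subseteq> ?A" by (rule Poly_Mapping.keys_add)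
  then show ?thesis
    by (simp add: mdeg_superset[of ?A] lookup_add sum.distrib)
qed

lemma monom_eval_single: "monom_eval (Poly_Mapping.single v k) x = x v ^ k"
  by (simp add: monom_eval_superset[of "{v}"])

lemma mdeg_single: "mdeg (Poly_Mapping.single v k) = k"
  by (simp add: mdeg_superset[of "{v}"])

lemma monom_eval_scale: "monom_eval t (\<lambda>i. c * x i) = c ^ mdeg t * monom_eval t x"
  by (simp add: monom_eval_def mdeg_def power_mult_distrib prod.distrib power_sum)

lemma peval_superset:
  assumes "finite A" "Poly_Mapping.keys q \<subseteq> A"
  shows "peval q x = (\<Sum>t\<in>A. Poly_Mapping.lookup q t * monom_eval t x)"
  unfolding peval_def monom_eval_def[symmetric]
  by (rule sum.mono_neutral_left) (use assms in \<open>auto simp: in_keys_iff\<close>)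

lemma peval_single: "peval (Poly_Mapping.single t c) x = c * monom_eval t x"
  by (simp add: peval_superset[of "{t}"])

lemma peval_zero [simp]: "peval 0 x = 0"
  by (simp add: peval_def)

lemma peval_add [simp]: "peval (q + r) x = peval q x + peval r x"
proof -
  let ?A = "Poly_Mapping.keys q \<union> Poly_Mapping.keys r"
  have "Poly_Mapping.keys (q + r) \<subseteq> ?A" by (rule Poly_Mapping.keys_add)
  then show ?thesis
    by (simp add: peval_superset[of ?A] lookup_add ring_distribs sum.distrib)
qed

lemma peval_uminus [simp]: "peval (- q) x = - peval q x"
  by (metis add.right_inverse add_eq_0_iff peval_add peval_zero)

lemma peval_diff [simp]: "peval (q - r) x = peval q x - peval r x"
  by (metis add_uminus_conv_diff peval_add peval_uminus)

lemma peval_sum [simp]: "peval (\<Sum>i\<in>A. F i) x = (\<Sum>i\<in>A. peval (F i) x)"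
  by (induction A rule: infinite_finite_induct) auto

text \<open>Both sides are bilinear, so it suffices to compare them on monomials.\<close>

lemma peval_mult [simp]: "peval (q * r) x = peval q x * peval r x"
proof -
  have expand: "(\<Sum>t\<in>Poly_Mapping.keys q. Poly_Mapping.single t (Poly_Mapping.lookup q t)) = q"
    for q :: rpoly
    by (rule poly_mapping_eqI)
      (auto simp: lookup_sum lookup_single when_def in_keys_iff intro!: sum.neutral)
  have "q * r = (\<Sum>t\<in>Poly_Mapping.keys q. \<Sum>u\<in>Poly_Mapping.keys r.
      Poly_Mapping.single (t + u) (Poly_Mapping.lookup q t * Poly_Mapping.lookup r u))"
    by (subst (1 2) expand[symmetric]) (simp add: sum_product mult_single)
  then show ?thesis
    by (simp add: peval_single monom_eval_add peval_superset[OF finite_keys order_refl, of q]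
        peval_superset[OF finite_keys order_refl, of r] sum_product mult_ac)
qed

lemma peval_Const [simp]: "peval (Const c) x = c"
  by (simp add: Const_def peval_single monom_eval_def)

lemma peval_Var [simp]: "peval (Var i) x = x i"
  by (simp add: Var_def peval_single monom_eval_single)

lemma peval_power [simp]: "peval (q ^ k) x = peval q x ^ k"
proof (induction k)
  case 0
  then show ?case using peval_Const[of 1] by (simp add: Const_def)
qed simp

lemma peval_cong:
  assumes "q \<in> polys k" "\<And>i. i < k \<Longrightarrow> x i = x' i"
  shows "peval q x = peval q x'"
  unfolding peval_def
proof (intro sum.cong arg_cong2[where f = "(*)"] prod.cong refl)
  fix t i assume "t \<in> Poly_Mapping.keys q" "i \<in> Poly_Mapping.keys t"
  then have "i < k" using assms(1) by (auto simp: polys_def)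
  then show "x i ^ Poly_Mapping.lookup t i = x' i ^ Poly_Mapping.lookup t i"
    using assms(2) by simp
qed

lemma continuous_on_peval: "continuous_on A (peval q)"
proof -
  have "continuous_on A (\<lambda>x::nat \<Rightarrow> real. x i)" for i
    by (rule continuous_on_subset[OF continuous_on_product_coordinates]) simp
  then have "continuous_on A (\<lambda>x. \<Sum>t\<in>Poly_Mapping.keys q. Poly_Mapping.lookup q t *
      (\<Prod>i\<in>Poly_Mapping.keys t. x i ^ Poly_Mapping.lookup t i))"
    by (intro continuous_intros)
  then show ?thesis by (simp add: peval_def[abs_def])
qed

section \<open>Forms\<close>

lemma forms_zero [intro]: "0 \<in> forms N k"
  by (simp add: forms_def polys_def)

lemma forms_add [intro]: "q \<in> forms N k \<Longrightarrow> r \<in> forms N k \<Longrightarrow> q + r \<in> forms N k"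
  using Poly_Mapping.keys_add[of q r] by (fastforce simp: forms_def polys_def)

lemma forms_uminus: "q \<in> forms N k \<Longrightarrow> - q \<in> forms N k"
  by (simp add: forms_def polys_def)

lemma forms_diff [intro]: "q \<in> forms N k \<Longrightarrow> r \<in> forms N k \<Longrightarrow> q - r \<in> forms N k"
  using forms_add[OF _ forms_uminus] by fastforce

lemma forms_sum [intro]: "(\<And>i. i \<in> A \<Longrightarrow> F i \<in> forms N k) \<Longrightarrow> (\<Sum>i\<in>A. F i) \<in> forms N k"
  by (induction A rule: infinite_finite_induct) auto

lemma forms_mult:
  assumes "q \<in> forms N k" "r \<in> forms N l"
  shows "q * r \<in> forms N (k + l)"
proof -
  have "Poly_Mapping.keys t \<subseteq> {..<N} \<and> mdeg t = k + l" if t: "t \<in> Poly_Mapping.keys (q * r)" for t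
  proof -
    obtain a b where ab: "t = a + b" "a \<in> Poly_Mapping.keys q" "b \<in> Poly_Mapping.keys r"
      using t keys_mult[of q r] by blast
    have "Poly_Mapping.keys a \<subseteq> {..<N}" "Poly_Mapping.keys b \<subseteq> {..<N}" "mdeg a = k" "mdeg b = l"
      using ab assms by (auto simp: forms_def polys_def)
    then show ?thesis
      using Poly_Mapping.keys_add[of a b] by (auto simp: ab(1) mdeg_add)
  qed
  then show ?thesis by (auto simp: forms_def polys_def)
qed

lemma forms_Const: "Const c \<in> forms N 0"
  by (auto simp: forms_def polys_def Const_def mdeg_def)

lemma forms_Const_mult [intro]: "q \<in> forms N k \<Longrightarrow> Const c * q \<in> forms N k"
  using forms_mult[OF forms_Const] by simp

lemma forms_Var: "i < N \<Longrightarrow> Var i \<in> forms N 1"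
  by (auto simp: forms_def polys_def Var_def mdeg_single)

lemma forms_power: "q \<in> forms N k \<Longrightarrow> q ^ j \<in> forms N (j * k)"
proof (induction j)
  case 0
  then show ?case using forms_Const[of 1] by (simp add: Const_def)
next
  case (Suc j)
  then show ?case using forms_mult[of q N k "q ^ j" "j * k"] by simp
qed

lemma forms_Var_power [intro]: "i < N \<Longrightarrow> Var i ^ j \<in> forms N j"
  using forms_power[OF forms_Var, of i N j] by simp

lemma forms_power_eq: "q \<in> forms N k \<Longrightarrow> l = j * k \<Longrightarrow> q ^ j \<in> forms N l"
  using forms_power by simp

lemma forms_mult_eq: "q \<in> forms N k \<Longrightarrow> r \<in> forms N k' \<Longrightarrow> l = k + k' \<Longrightarrow> q * r \<in> forms N l"
  using forms_mult by simp

lemma peval_form_scale: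
  assumes "q \<in> forms N k"
  shows "peval q (\<lambda>i. c * x i) = c ^ k * peval q x"
  using assms
  by (simp add: peval_superset[OF finite_keys order_refl] monom_eval_scale sum_distrib_left
      forms_def mult_ac)

lemma mdeg_le_total_degree: "t \<in> Poly_Mapping.keys q \<Longrightarrow> mdeg t \<le> total_degree q"
  by (simp add: total_degree_def)

lemma homog_form:
  assumes "q \<in> polys n" "total_degree q \<le> k" "n \<le> N" "v < N"
  shows "homog v k q \<in> forms N k"
  unfolding homog_def
proof (rule forms_sum)
  fix t assume t: "t \<in> Poly_Mapping.keys q"
  let ?u = "t + Poly_Mapping.single v (k - mdeg t)"
  have "Poly_Mapping.keys t \<subseteq> {..<N}"
    using t assms by (fastforce simp: polys_def)
  moreover have "Poly_Mapping.keys (Poly_Mapping.single v (k - mdeg t)) \<subseteq> {..<N}"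
    using assms by auto
  ultimately have "Poly_Mapping.keys ?u \<subseteq> {..<N}"
    using Poly_Mapping.keys_add[of t "Poly_Mapping.single v (k - mdeg t)"] by blast
  moreover have "mdeg ?u = k"
    using mdeg_le_total_degree[OF t] assms by (simp add: mdeg_add mdeg_single)
  ultimately show "Poly_Mapping.single ?u (Poly_Mapping.lookup q t) \<in> forms N k"
    by (auto simp: forms_def polys_def)
qed

lemma peval_homog:
  assumes deg: "total_degree q \<le> k" and y: "z v \<noteq> 0"
  shows "peval (homog v k q) z = z v ^ k * peval q (\<lambda>i. z i / z v)"
proof -
  have "monom_eval t z * z v ^ (k - mdeg t) = z v ^ k * monom_eval t (\<lambda>i. z i / z v)"
    if t: "t \<in> Poly_Mapping.keys q" for t
  proof -
    have le: "mdeg t \<le> k" using mdeg_le_total_degree[OF t] deg by simp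
    have "monom_eval t z = z v ^ mdeg t * monom_eval t (\<lambda>i. z i / z v)"
      using monom_eval_scale[of t "z v" "\<lambda>i. z i / z v"] y by simp
    then have "monom_eval t z * z v ^ (k - mdeg t) =
        (z v ^ mdeg t * z v ^ (k - mdeg t)) * monom_eval t (\<lambda>i. z i / z v)"
      by (simp add: mult_ac)
    then show ?thesis using le by (simp flip: power_add)
  qed
  then show ?thesis
    unfolding homog_def peval_sum peval_single monom_eval_add monom_eval_single
      peval_superset[OF finite_keys order_refl, of q] sum_distrib_left
    by (intro sum.cong) (simp_all add: mult_ac)
qed

section \<open>Positive definite forms stay so after a small perturbation\<close>

lemma compact_sphere_points: "compact {z \<in> points N. (\<Sum>i<N. (z i)\<^sup>2) = 1}" (is "compact ?S")
proof -
  \<comment> \<open>Points are constant outside \<open>{..<N}\<close>, so the cube below is a product of compact sets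
    over all indices and Tychonoff's theorem applies.\<close>
  let ?B = "\<lambda>i. if i < N then {-1..1::real} else {undefined}"
  have "compactin (product_topology (\<lambda>i. euclidean) UNIV) (PiE UNIV ?B)"
    by (subst compactin_PiE) auto
  then have "compact (PiE UNIV ?B)"
    by (simp add: euclidean_product_topology)
  moreover have "closed {z::nat \<Rightarrow> real. (\<Sum>i<N. (z i)\<^sup>2) = 1}"
    by (intro closed_Collect_eq continuous_intros continuous_on_product_coordinates)
  ultimately have "compact (PiE UNIV ?B \<inter> {z. (\<Sum>i<N. (z i)\<^sup>2) = 1})"
    by (rule compact_Int_closed)
  moreover have "PiE UNIV ?B \<inter> {z. (\<Sum>i<N. (z i)\<^sup>2) = 1} = ?S"
  proof (intro equalityI subsetI)
    fix z assume "z \<in> PiE UNIV ?B \<inter> {z. (\<Sum>i<N. (z i)\<^sup>2) = 1}"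
    then have cube: "z i \<in> ?B i" and one: "(\<Sum>i<N. (z i)\<^sup>2) = 1" for i
      by (auto simp: PiE_iff)
    have "z i = undefined" if "i \<notin> {..<N}" for i
      using cube[of i] that by simp
    then show "z \<in> ?S"
      using one by (simp add: PiE_iff extensional_def)
  next
    fix z assume z: "z \<in> ?S"
    have "\<bar>z i\<bar> \<le> 1" if "i < N" for i
    proof -
      have "(z i)\<^sup>2 \<le> (\<Sum>i<N. (z i)\<^sup>2)"
        using that by (intro member_le_sum) auto
      then show ?thesis using z by (simp add: abs_square_le_1)
    qed
    then have "z i \<in> ?B i" for i
      using z by (auto simp: PiE_iff extensional_def abs_le_iff minus_le_iff)
    then show "z \<in> PiE UNIV ?B \<inter> {z. (\<Sum>i<N. (z i)\<^sup>2) = 1}"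
      using z by (simp add: PiE_iff)
  qed
  ultimately show ?thesis by simp
qed

text \<open>A form of degree \<open>k\<close> satisfies \<open>q(z) = c\<^sup>k q(z/c)\<close> with \<open>c = \<parallel>z\<parallel>\<close>, so its sign is decided
  on the unit sphere.\<close>

lemma pos_def_if_pos_on_sphere:
  assumes q: "q \<in> forms N k"
    and pos: "\<And>z. z \<in> points N \<Longrightarrow> (\<Sum>i<N. (z i)\<^sup>2) = 1 \<Longrightarrow> 0 < peval q z"
  shows "q \<in> pos_def_forms N k"
  unfolding pos_def_forms_def
proof (intro CollectI conjI ballI impI q)
  fix z assume z: "z \<in> points N" "\<exists>i<N. z i \<noteq> 0"
  define c where "c = sqrt (\<Sum>i<N. (z i)\<^sup>2)"
  define u where "u = (\<lambda>i\<in>{..<N}. z i / c)"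
  have "0 < (\<Sum>i<N. (z i)\<^sup>2)"
    using z(2) by (auto intro: sum_pos2)
  then have c: "c > 0" "c\<^sup>2 = (\<Sum>i<N. (z i)\<^sup>2)"
    by (auto simp: c_def)
  have "(\<Sum>i<N. (u i)\<^sup>2) = (\<Sum>i<N. (z i)\<^sup>2) / c\<^sup>2"
    by (simp add: u_def power_divide sum_divide_distrib)
  also have "\<dots> = 1"
    unfolding c(2)[symmetric] using c(1) by simp
  finally have "(\<Sum>i<N. (u i)\<^sup>2) = 1" .
  then have "0 < peval q u"
    by (intro pos) (auto simp: u_def)
  moreover have "peval q z = peval q (\<lambda>i. c * u i)"
    by (rule peval_cong[of _ N]) (use q c in \<open>auto simp: forms_def u_def\<close>)
  ultimately show "0 < peval q z"
    using c by (simp add: peval_form_scale[OF q])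
qed

text \<open>On the compact unit sphere \<open>q\<close> is bounded below by some \<open>\<delta> > 0\<close> and \<open>s\<close> is bounded above by
  some \<open>M\<close>; any positive \<open>j > M/\<delta>\<close> works.\<close>

lemma pos_def_minus_small_multiple:
  assumes q: "q \<in> pos_def_forms N k" and s: "s \<in> forms N k"
  shows "\<exists>j\<ge>1. q - Const (1 / real j) * s \<in> pos_def_forms N k"
proof -
  define S where "S = {z \<in> points N. (\<Sum>i<N. (z i)\<^sup>2) = 1}"
  have S: "compact S" unfolding S_def by (rule compact_sphere_points)
  have qf: "q \<in> forms N k" using q by (simp add: pos_def_forms_def)
  have qpos: "0 < peval q z" if "z \<in> S" for z
  proof -
    have "\<exists>i<N. z i \<noteq> 0"
    proof (rule ccontr)
      assume "\<not> (\<exists>i<N. z i \<noteq> 0)"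
      then have "(\<Sum>i<N. (z i)\<^sup>2) = 0" by simp
      with that show False by (simp add: S_def)
    qed
    then show ?thesis using that q by (auto simp: pos_def_forms_def S_def)
  qed
  have "\<exists>\<delta>>0. \<forall>z\<in>S. \<delta> \<le> peval q z"
  proof (cases "S = {}")
    case False
    then obtain z where "z \<in> S" "\<forall>w\<in>S. peval q z \<le> peval q w"
      using continuous_attains_inf[OF S False continuous_on_peval] by blast
    then show ?thesis using qpos by blast
  qed (simp add: exI[of _ 1])
  then obtain \<delta> where \<delta>: "\<delta> > 0" "\<And>z. z \<in> S \<Longrightarrow> \<delta> \<le> peval q z" by blast
  have "\<exists>M. \<forall>z\<in>S. peval s z \<le> M"
  proof (cases "S = {}")
    case False
    then show ?thesis
      using continuous_attains_sup[OF S False continuous_on_peval] by blast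
  qed auto
  then obtain M where M: "\<And>z. z \<in> S \<Longrightarrow> peval s z \<le> M" by blast
  obtain j :: nat where j: "max 1 (M / \<delta>) < real j"
    using reals_Archimedean2 by blast
  have "q - Const (1 / real j) * s \<in> pos_def_forms N k"
  proof (rule pos_def_if_pos_on_sphere)
    fix z assume z: "z \<in> points N" "(\<Sum>i<N. (z i)\<^sup>2) = 1"
    have "peval s z \<le> M" using M z by (simp add: S_def)
    also have "M < \<delta> * real j" using j \<delta>(1) by (simp add: field_simps)
    also have "\<dots> \<le> peval q z * real j" using \<delta>(2)[of z] z by (simp add: S_def mult_right_mono)
    finally show "0 < peval (q - Const (1 / real j) * s) z"
      using j by (simp add: field_simps)
  qed (use qf s in auto)
  then show ?thesis using j by (intro exI[of _ j]) auto
qed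

section \<open>The zeros of the form encode feasible points\<close>

lemma peval_f_form:
  "peval (f_form n m d R \<eta> \<beta> p g \<gamma>) z =
     (\<gamma> * z (n + m + 2) ^ (2 * d) - peval (homog (n + m + 2) (2 * d) p) z
        - z n ^ 2 * z (n + m + 2) ^ (2 * d - 2)) ^ 2
   + (\<Sum>i=1..m. (peval (homog (n + m + 2) (2 * d) (g i)) z
        - z (n + i) ^ 2 * z (n + m + 2) ^ (2 * d - 2)) ^ 2)
   + ((R + (\<Sum>i=1..m. \<eta> i) + \<beta> + \<gamma>) ^ d * z (n + m + 2) ^ (2 * d)
        - ((\<Sum>j<n. z j ^ 2) + (\<Sum>i=0..m. z (n + i) ^ 2)) ^ d
        - z (n + (m + 1)) ^ (2 * d)) ^ 2"
  unfolding f_form_def Let_def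
  by (simp only: peval_add peval_diff peval_mult peval_power peval_sum peval_Const peval_Var
      add_0_right)

lemma f_form_form:
  assumes "d \<ge> 1" and p: "p \<in> polys n" "total_degree p \<le> 2 * d"
    and g: "\<And>i. i \<in> {1..m} \<Longrightarrow> g i \<in> polys n \<and> total_degree (g i) \<le> 2 * d"
  shows "f_form n m d R \<eta> \<beta> p g \<gamma> \<in> forms (n + m + 3) (4 * d)"
proof -
  let ?N = "n + m + 3" and ?v = "n + m + 2"
  have sq: "Var (n + i) ^ 2 * Var ?v ^ (2 * d - 2) \<in> forms ?N (2 * d)" if "i \<le> m" for i
    by (rule forms_mult_eq[OF forms_Var_power forms_Var_power]) (use that assms in auto)
  have H: "homog ?v (2 * d) q \<in> forms ?N (2 * d)"
    if "q \<in> polys n" "total_degree q \<le> 2 * d" for q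
    by (rule homog_form[OF that]) auto
  have ball: "((\<Sum>j<n. Var j ^ 2) + (\<Sum>i=0..m. Var (n + i) ^ 2)) ^ d \<in> forms ?N (2 * d)"
    by (intro forms_power_eq[where k = 2] forms_add forms_sum forms_Var_power) auto
  have y: "Const c * Var ?v ^ (2 * d) \<in> forms ?N (2 * d)" for c
    by (intro forms_Const_mult forms_Var_power) auto
  show ?thesis
    unfolding f_form_def Let_def
    by (intro forms_add forms_sum; rule forms_power_eq[where k = "2 * d"])
      (use y sq[of 0] sq ball H p g in \<open>auto intro!: forms_diff\<close>)
qed

text \<open>At \<open>y \<noteq> 0\<close> the equations can be dehomogenized. The slacks occur as \<open>s\<^sub>i\<^sup>2 y\<^bsup>2d-2\<^esup>\<close>, that is
  \<open>y\<^bsup>2d\<^esup> (s\<^sub>i/y)\<^sup>2\<close>, so they express a sign condition on the polynomial.\<close>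

lemma homog_slack_nonneg:
  fixes y s :: real
  assumes "d \<ge> 1" "y \<noteq> 0" "y ^ (2 * d) * a = s ^ 2 * y ^ (2 * d - 2)"
  shows "a \<ge> 0"
proof -
  have "0 \<le> y ^ (2 * d) * a"
    unfolding assms(3) by (intro mult_nonneg_nonneg zero_le_even_power) (use assms in auto)
  moreover have "0 < y ^ (2 * d)" using assms by (simp add: zero_less_power_eq)
  ultimately show ?thesis by (simp add: zero_le_mult_iff)
qed

text \<open>A nonzero zero \<open>z\<close> has \<open>y \<noteq> 0\<close>: at \<open>y = 0\<close> the last equation says that a sum of two
  nonnegative terms, which together involve all other variables, vanishes. So \<open>x/y\<close> would be
  feasible with value at most \<open>\<gamma>\<close>.\<close>

lemma f_form_pos_def:
  assumes d: "d \<ge> 1" and p: "p \<in> polys n" "total_degree p \<le> 2 * d"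
    and g: "\<And>i. i \<in> {1..m} \<Longrightarrow> g i \<in> polys n \<and> total_degree (g i) \<le> 2 * d"
    and \<gamma>: "\<And>x. x \<in> feasible n m g \<Longrightarrow> \<gamma> < peval p x"
  shows "f_form n m d R \<eta> \<beta> p g \<gamma> \<in> pos_def_forms (n + m + 3) (4 * d)" (is "?f \<in> _")
  unfolding pos_def_forms_def
proof (intro CollectI conjI ballI impI)
  show "?f \<in> forms (n + m + 3) (4 * d)" by (rule f_form_form) (use assms in auto)
next
  fix z assume z: "z \<in> points (n + m + 3)" "\<exists>i<n + m + 3. z i \<noteq> 0"
  let ?y = "z (n + m + 2)"
  define A where "A = \<gamma> * ?y ^ (2 * d) - peval (homog (n + m + 2) (2 * d) p) z
        - z n ^ 2 * ?y ^ (2 * d - 2)"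
  define B where "B i = peval (homog (n + m + 2) (2 * d) (g i)) z
        - z (n + i) ^ 2 * ?y ^ (2 * d - 2)" for i
  define E where "E = (\<Sum>j<n. z j ^ 2) + (\<Sum>i=0..m. z (n + i) ^ 2)"
  define C where "C = (R + (\<Sum>i=1..m. \<eta> i) + \<beta> + \<gamma>) ^ d * ?y ^ (2 * d)
        - E ^ d - z (n + (m + 1)) ^ (2 * d)"
  have f: "peval ?f z = A\<^sup>2 + (\<Sum>i=1..m. (B i)\<^sup>2) + C\<^sup>2"
    unfolding peval_f_form A_def B_def C_def E_def ..
  have Bnn: "0 \<le> (\<Sum>i=1..m. (B i)\<^sup>2)" by (rule sum_nonneg) simp
  have "\<not> (A = 0 \<and> (\<forall>i\<in>{1..m}. B i = 0) \<and> C = 0)"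
  proof
    assume 0: "A = 0 \<and> (\<forall>i\<in>{1..m}. B i = 0) \<and> C = 0"
    show False
    proof (cases "?y = 0")
      case True
      have E0: "0 \<le> (\<Sum>j<n. z j ^ 2)" "0 \<le> (\<Sum>i=0..m. z (n + i) ^ 2)"
        by (simp_all add: sum_nonneg)
      then have "0 \<le> E ^ d" by (simp add: E_def)
      moreover have "0 \<le> z (n + (m + 1)) ^ (2 * d)" by (rule zero_le_even_power) simp
      moreover have "E ^ d + z (n + (m + 1)) ^ (2 * d) = 0"
        using 0 True d by (simp add: C_def power_0_left del: add_2_eq_Suc')
      ultimately have Ed: "E ^ d = 0" and last: "z (n + (m + 1)) ^ (2 * d) = 0" by linarith+
      have "E = 0" using Ed by (metis power_eq_0_iff)
      then have "(\<Sum>j<n. z j ^ 2) = 0" "(\<Sum>i=0..m. z (n + i) ^ 2) = 0"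
        using E0 by (simp_all add: E_def)
      then have x: "\<And>j. j < n \<Longrightarrow> z j = 0" and t: "\<And>i. i \<le> m \<Longrightarrow> z (n + i) = 0"
        by (simp_all add: sum_nonneg_eq_0_iff)
      obtain i where i: "i < n + m + 3" "z i \<noteq> 0" using z(2) by blast
      consider "i < n" | "n \<le> i" "i - n \<le> m" | "i = n + (m + 1)" | "i = n + m + 2"
        using i(1) by linarith
      then show False
        using x[of i] t[of "i - n"] last True i(2) by cases auto
    next
      case False
      define x where "x = (\<lambda>j\<in>{..<n}. z j / ?y)"
      have hom: "peval (homog (n + m + 2) (2 * d) q) z = ?y ^ (2 * d) * peval q x"
        if "q \<in> polys n" "total_degree q \<le> 2 * d" for q
        using peval_homog[of q "2 * d" z "n + m + 2"] that False
          peval_cong[of q n x "\<lambda>i. z i / ?y"] by (simp add: x_def)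
      have "peval (g i) x \<ge> 0" if "i \<in> {1..m}" for i
        using 0 that g[OF that] hom[of "g i"]
        by (intro homog_slack_nonneg[OF d False, of _ "z (n + i)"]) (auto simp: B_def)
      then have "x \<in> feasible n m g" by (auto simp: feasible_def x_def)
      moreover have "\<gamma> - peval p x \<ge> 0"
        using 0 hom[OF p]
        by (intro homog_slack_nonneg[OF d False, of _ "z n"]) (auto simp: A_def algebra_simps)
      ultimately show False using \<gamma>[of x] by simp
    qed
  qed
  then consider "A \<noteq> 0" | i where "i \<in> {1..m}" "B i \<noteq> 0" | "C \<noteq> 0" by blast
  then show "0 < peval ?f z"
  proof cases
    case 2
    then have "0 < (\<Sum>i=1..m. (B i)\<^sup>2)" by (intro sum_pos2[of _ i]) auto
    then show ?thesis by (simp add: f add_nonneg_pos add_pos_nonneg)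
  qed (use Bnn in \<open>auto simp: f add_nonneg_pos add_pos_nonneg\<close>)
qed

text \<open>Put \<open>y = 1\<close> and solve the equations for the slacks. The last one asks for a \<open>2d\<close>-th root of
  \<open>M\<^sup>d - E\<^sup>d\<close>, where \<open>M = R + \<Sum>\<eta>\<^sub>i + \<beta> + \<gamma>\<close> and \<open>E = \<Sum>x\<^sub>i\<^sup>2 + \<Sum>s\<^sub>i\<^sup>2\<close>; this is where the bounds
  on the feasible set enter.\<close>

lemma f_form_zero:
  assumes d: "d \<ge> 1" and p: "p \<in> polys n" "total_degree p \<le> 2 * d"
    and g: "\<And>i. i \<in> {1..m} \<Longrightarrow> g i \<in> polys n \<and> total_degree (g i) \<le> 2 * d"
    and x: "x \<in> feasible n m g" "peval p x \<le> \<gamma>"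
    and R: "(\<Sum>j<n. (x j)\<^sup>2) \<le> R"
    and \<eta>: "\<And>i. i \<in> {1..m} \<Longrightarrow> peval (g i) x \<le> \<eta> i"
    and \<beta>: "- peval p x \<le> \<beta>"
  shows "\<exists>z\<in>points (n + m + 3). (\<exists>i<n + m + 3. z i \<noteq> 0) \<and>
           peval (f_form n m d R \<eta> \<beta> p g \<gamma>) z = 0"
proof -
  define t where "t i = sqrt (if i = 0 then \<gamma> - peval p x else peval (g i) x)" for i
  define M where "M = R + (\<Sum>i=1..m. \<eta> i) + \<beta> + \<gamma>"
  define E where "E = (\<Sum>j<n. (x j)\<^sup>2) + (\<Sum>i=0..m. (t i)\<^sup>2)"
  define w where "w = root (2 * d) (M ^ d - E ^ d)"
  define z where "z = (\<lambda>i\<in>{..<n + m + 3}. if i < n then x i else if i \<le> n + m then t (i - n)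
      else if i = n + m + 1 then w else 1)"
  have z_simps: "\<And>j. j < n \<Longrightarrow> z j = x j" "\<And>i. i \<le> m \<Longrightarrow> z (n + i) = t i"
    "z n = t 0" "z (n + (m + 1)) = w" "z (n + m + 2) = 1"
    by (auto simp: z_def)
  have g_nonneg: "0 \<le> peval (g i) x" if "i \<in> {1..m}" for i
    using x that by (simp add: feasible_def)
  have t0: "(t 0)\<^sup>2 = \<gamma> - peval p x" using x by (simp add: t_def)
  have t: "(t i)\<^sup>2 = peval (g i) x" if "i \<in> {1..m}" for i
    using g_nonneg[OF that] that by (simp add: t_def)
  \<comment> \<open>The bounds on \<open>\<parallel>x\<parallel>\<^sup>2\<close>, on the \<open>g\<^sub>i(x)\<close> and on \<open>\<gamma> - p(x)\<close> add up to \<open>E \<le> M\<close>.\<close>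
  have "(\<Sum>i=0..m. (t i)\<^sup>2) = (\<gamma> - peval p x) + (\<Sum>i=1..m. peval (g i) x)"
    using t by (simp add: sum.atLeast_Suc_atMost t0)
  also have "\<dots> \<le> (\<gamma> + \<beta>) + (\<Sum>i=1..m. \<eta> i)"
    using \<beta> \<eta> by (intro add_mono sum_mono) auto
  finally have "E \<le> M" using R by (simp add: E_def M_def)
  moreover have "0 \<le> E" by (simp add: E_def sum_nonneg add_nonneg_nonneg)
  ultimately have "E ^ d \<le> M ^ d" by (rule power_mono)
  then have w: "w ^ (2 * d) = M ^ d - E ^ d"
    unfolding w_def using d by (intro real_root_pow_pos2) auto
  have hom: "peval (homog (n + m + 2) (2 * d) q) z = peval q x"
    if "q \<in> polys n" "total_degree q \<le> 2 * d" for q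
    using peval_homog[of q "2 * d" z "n + m + 2"] that
      peval_cong[of q n z x] by (simp add: z_simps del: add_2_eq_Suc')
  have "peval (f_form n m d R \<eta> \<beta> p g \<gamma>) z =
      (\<gamma> - peval p x - (t 0)\<^sup>2)\<^sup>2 + (\<Sum>i=1..m. (peval (g i) x - (t i)\<^sup>2)\<^sup>2)
        + (M ^ d - E ^ d - w ^ (2 * d))\<^sup>2"
    unfolding peval_f_form M_def E_def using hom[OF p] hom g
    by (simp add: z_simps del: add_2_eq_Suc' add_Suc_right One_nat_def)
  also have "\<dots> = 0" using t t0 w by simp
  finally have "peval (f_form n m d R \<eta> \<beta> p g \<gamma>) z = 0" .
  moreover have "z \<in> points (n + m + 3)" by (simp add: z_def)
  moreover have "\<exists>i<n + m + 3. z i \<noteq> 0"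
    by (rule exI[of _ "n + m + 2"]) (simp add: z_simps del: add_2_eq_Suc')
  ultimately show ?thesis by blast
qed

section \<open>The hierarchy of lower bounds\<close>

lemma Const_diff: "Const (a - b) = Const a - Const b"
  by (simp add: Const_def single_diff)

text \<open>Passing from \<open>1/r\<close> to \<open>1/r'\<close> adds the multiple \<open>1/r - 1/r' \<in> [0, 1]\<close> of \<open>s\<close>.\<close>

lemma certificate_mono:
  fixes K :: "nat \<Rightarrow> rpoly set"
  assumes mono: "mono K"
    and add: "\<And>r q \<epsilon>. q \<in> K r \<Longrightarrow> \<epsilon> \<in> {0..1} \<Longrightarrow> q + Const \<epsilon> * s \<in> K r"
    and r: "1 \<le> r" "r \<le> r'" "k \<le> r'" and q: "q - Const (1 / real r) * s \<in> K k"
  shows "q - Const (1 / real r') * s \<in> K r'"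
proof -
  have "q - Const (1 / real r) * s \<in> K r'" using q monoD[OF mono r(3)] by blast
  moreover have "1 / real r - 1 / real r' \<in> {0..1}"
  proof -
    have "1 / real r' \<le> 1 / real r" "1 / real r \<le> 1" "0 \<le> 1 / real r'"
      using r by (auto intro: divide_left_mono)
    then show ?thesis unfolding atLeastAtMost_iff by linarith
  qed
  ultimately have "q - Const (1 / real r) * s + Const (1 / real r - 1 / real r') * s \<in> K r'"
    by (rule add)
  then show ?thesis by (simp add: Const_diff algebra_simps)
qed

theorem theorem4p2p4:
  fixes n m d N D :: nat
    and p s :: rpoly
    and g :: "nat \<Rightarrow> rpoly"
    and R \<beta> :: real
    and \<eta> :: "nat \<Rightarrow> real"
    and K :: "nat \<Rightarrow> rpoly set"
    and l :: "nat \<Rightarrow> ereal"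
  assumes p: "p \<in> polys n"
    and g: "\<forall>i\<in>{1..m}. g i \<in> polys n"
    and d: "d \<ge> 1"
      "2 * d = (LEAST k. even k \<and> 0 < k \<and> total_degree p \<le> k \<and>
                  (\<forall>i\<in>{1..m}. total_degree (g i) \<le> k))"
    and R: "R > 0" "\<forall>x\<in>feasible n m g. (\<Sum>j<n. (x j)\<^sup>2) \<le> R"
    and \<eta>: "\<forall>i\<in>{1..m}. \<forall>x\<in>feasible n m g. peval (g i) x \<le> \<eta> i"
    and \<beta>: "\<forall>x\<in>feasible n m g. - peval p x \<le> \<beta>"
    and N: "N = n + m + 3"
    and D: "D = 2 * d"
    and K_nonneg: "\<forall>r. K r \<subseteq> nonneg_forms N (2 * D)"
    and s: "s \<in> K 0" "s \<in> pos_def_forms N (2 * D)"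
    and K_pos_def: "\<forall>q\<in>pos_def_forms N (2 * D). \<exists>r. q \<in> K r"
    and K_mono: "\<forall>r. K r \<subseteq> K (r + 1)"
    and K_add: "\<forall>r. \<forall>q\<in>K r. \<forall>\<epsilon>\<in>{0..1}. q + Const \<epsilon> * s \<in> K r"
    and l: "\<forall>r\<ge>1. l r = lower_bound K (f_form n m d R \<eta> \<beta> p g) s r"
  shows "(\<forall>r\<ge>1. l r \<le> opt_value n m p g)
       \<and> mono_on {1..} l
       \<and> l \<longlonglongrightarrow> opt_value n m p g"
proof -
  define f where "f = f_form n m d R \<eta> \<beta> p g"
  let ?deg = "\<lambda>k. even k \<and> 0 < k \<and> total_degree p \<le> k \<and> (\<forall>i\<in>{1..m}. total_degree (g i) \<le> k)"
  \<comment> \<open>An even bound on all degrees exists, so the least one is attained by \<open>2 * d\<close>.\<close>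
  have "?deg (2 * (1 + total_degree p + (\<Sum>i=1..m. total_degree (g i))))"
  proof -
    have "total_degree (g i) \<le> (\<Sum>i=1..m. total_degree (g i))" if "i \<in> {1..m}" for i
      using that by (intro member_le_sum) auto
    then show ?thesis by fastforce
  qed
  then have "?deg (2 * d)" unfolding d(2) by (rule LeastI)
  then have pd: "total_degree p \<le> 2 * d"
    and gd: "\<And>i. i \<in> {1..m} \<Longrightarrow> g i \<in> polys n \<and> total_degree (g i) \<le> 2 * d"
    using g by auto
  have K: "mono K"
    using K_mono by (intro mono_iff_le_Suc[THEN iffD2]) simp
  have cert: "q - Const (1 / real r') * s \<in> K r'"
    if "1 \<le> r" "r \<le> r'" "k \<le> r'" "q - Const (1 / real r) * s \<in> K k" for q r r' k
    using certificate_mono[OF K _ that] K_add by blast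
  have l_eq: "l r = (SUP \<gamma>\<in>{\<gamma>. f \<gamma> - Const (1 / real r) * s \<in> K r}. ereal \<gamma>)" if "r \<ge> 1" for r
    using l that by (simp add: lower_bound_def f_def)

  have upper: "l r \<le> opt_value n m p g" if r: "r \<ge> 1" for r
    unfolding l_eq[OF r] opt_value_def
  proof (intro SUP_least INF_greatest)
    fix \<gamma> x assume \<gamma>: "\<gamma> \<in> {\<gamma>. f \<gamma> - Const (1 / real r) * s \<in> K r}" and x: "x \<in> feasible n m g"
    show "ereal \<gamma> \<le> ereal (peval p x)"
    proof (rule ccontr)
      assume "\<not> ereal \<gamma> \<le> ereal (peval p x)"
      then have "peval p x \<le> \<gamma>" by simp
      then obtain z where z: "z \<in> points N" "\<exists>i<N. z i \<noteq> 0" "peval (f \<gamma>) z = 0"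
        using f_form_zero[OF d(1) p pd gd x, of \<gamma> R \<eta> \<beta>] R(2) \<eta> \<beta> x unfolding f_def N by blast
      have "0 < peval s z" using s(2) z by (simp add: pos_def_forms_def)
      then have "peval (f \<gamma> - Const (1 / real r) * s) z < 0"
        using z(3) r by simp
      moreover have "0 \<le> peval (f \<gamma> - Const (1 / real r) * s) z"
      proof -
        have "f \<gamma> - Const (1 / real r) * s \<in> nonneg_forms N (2 * D)"
          using \<gamma> K_nonneg by blast
        then show ?thesis using z(1) by (simp add: nonneg_forms_def)
      qed
      ultimately show False by simp
    qed
  qed

  have "mono_on {1..} l"
  proof (intro mono_onI)
    fix r r' :: nat assume r: "r \<in> {1..}" "r' \<in> {1..}" "r \<le> r'"
    then show "l r \<le> l r'"
      using cert[of r r' r] by (auto simp: l_eq intro!: SUP_subset_mono)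
  qed

  moreover have "l \<longlonglongrightarrow> opt_value n m p g"
  proof (rule order_tendstoI)
    fix a assume "a < opt_value n m p g"
    then obtain \<gamma> where \<gamma>: "a < ereal \<gamma>" "ereal \<gamma> < opt_value n m p g"
      using ereal_dense2 by blast
    have "\<gamma> < peval p x" if "x \<in> feasible n m g" for x
      using \<gamma>(2) INF_lower[OF that, of "\<lambda>x. ereal (peval p x)"]
      unfolding opt_value_def by (meson less_ereal.simps(1) less_le_trans)
    then have "f \<gamma> \<in> pos_def_forms N (2 * D)"
      using f_form_pos_def[OF d(1) p pd gd] unfolding f_def N D by simp
    moreover have "s \<in> forms N (2 * D)" using s(2) by (simp add: pos_def_forms_def)
    ultimately obtain j where j: "j \<ge> 1" "f \<gamma> - Const (1 / real j) * s \<in> pos_def_forms N (2 * D)"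
      using pos_def_minus_small_multiple by blast
    then obtain k where k: "f \<gamma> - Const (1 / real j) * s \<in> K k"
      using K_pos_def by blast
    have "a < l r" if r: "r \<ge> max j k" for r
    proof -
      have "f \<gamma> - Const (1 / real r) * s \<in> K r"
        by (rule cert[OF j(1) _ _ k]) (use r in auto)
      then have "ereal \<gamma> \<le> l r"
        using r j(1) by (subst l_eq) (auto intro: SUP_upper)
      then show ?thesis using \<gamma>(1) by simp
    qed
    then show "\<forall>\<^sub>F r in sequentially. a < l r"
      unfolding eventually_sequentially by blast
  next
    fix a assume "opt_value n m p g < a"
    then show "\<forall>\<^sub>F r in sequentially. l r < a"
      unfolding eventually_sequentially using upper le_less_trans by blast
  qed

  ultimately show ?thesis using upper by blast
qed

end
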